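(* Let $m\ge0$ be an integer, let $\psi,\varphi,\phi$ be entire functions, and let $\mathbb{S}$ be a multi-valued weighted composition operator on $\mathcal{F}^2$ induced by the equation $\psi\cdot f\circ\varphi=\phi\cdot g^{(m)}$. If $\mathrm{dom}(\mathbb{S})$ is dense in $\mathcal{F}^2$, then $\mathbb{S}^*$ is a single-valued operator, i.e. $\mathbb{S}^*(0)=\{0\}$.
   Context: Fock space $\mathcal{F}^2$ is the Hilbert space of entire functions $f$ with $\int_{\mathbb{C}}|f(z)|^2e^{-|z|^2}dV(z)<\infty$, with inner product $\langle f,g\rangle=\frac1\pi\int_{\mathbb{C}}f(z)\overline{g(z)}e^{-|z|^2}dV(z)$, where $dV$ is area measure. A multi-valued linear operator $\mathbb{A}$ on a Hilbert space $\mathcal{H}$ assigns to each $x$ in a subspace $\mathrm{dom}(\mathbb{A})\subset\mathcal{H}$ a nonempty subset $\mathbb{A}(x)\subset\mathcal{H}$ such that its graph $G(\mathbb{A})=\{(x,y):x\in\mathrm{dom}(\mathbb{A}),\,y\in\mathbb{A}(x)\}$ is a linear subspace of $\mathcal{H}\times\mathcal{H}$. A multi-valued weighted composition operator induced by the equation is any multi-valued linear operator $\mathbb{S}$ on $\mathcal{F}^2$ such that every $(f,g)\in G(\mathbb{S})$ satisfies $\psi(z)f(\varphi(z))=\phi(z)g^{(m)}(z)$ for all $z\in\mathbb{C}$. The adjoint $\mathbb{A}^*$ is given by $G(\mathbb{A}^* )=\{(u,v):\langle g,u\rangle=\langle f,v\rangle\ \forall (f,g)\in G(\mathbb{A})\}$.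 *)

theory Defs
  imports "HOL-Complex_Analysis.Complex_Analysis"
begin

definition fock_space :: "(complex \<Rightarrow> complex) set" where
  "fock_space = {f. f holomorphic_on UNIV \<and>
     integrable lborel (\<lambda>z. (norm (f z))\<^sup>2 * exp (- (norm z)\<^sup>2))}"

definition fock_inner :: "(complex \<Rightarrow> complex) \<Rightarrow> (complex \<Rightarrow> complex) \<Rightarrow> complex" where
  "fock_inner f g =
     1 / complex_of_real pi *
       (\<integral>z. f z * cnj (g z) * complex_of_real (exp (- (norm z)\<^sup>2)) \<partial>lborel)"

definition fock_norm :: "(complex \<Rightarrow> complex) \<Rightarrow> real" where
  "fock_norm f = sqrt (Re (fock_inner f f))"

definition fock_dense :: "(complex \<Rightarrow> complex) set \<Rightarrow> bool" where
  "fock_dense D \<longleftrightarrow> D \<subseteq> fock_space \<and>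
     (\<forall>f\<in>fock_space. \<forall>e>0. \<exists>g\<in>D. fock_norm (\<lambda>z. f z - g z) < e)"

text \<open>
  A multi-valued operator is a set-valued map on functions. It is extended by the empty set
  outside its domain, so that the domain consists of the points where the value is nonempty.
\<close>

type_synonym mv_operator = "(complex \<Rightarrow> complex) \<Rightarrow> (complex \<Rightarrow> complex) set"

definition mv_dom :: "mv_operator \<Rightarrow> (complex \<Rightarrow> complex) set" where
  "mv_dom A = {f. A f \<noteq> {}}"

definition mv_graph :: "mv_operator \<Rightarrow> ((complex \<Rightarrow> complex) \<times> (complex \<Rightarrow> complex)) set" where
  "mv_graph A = {(f, g). f \<in> mv_dom A \<and> g \<in> A f}"

text \<open>
  The graph is a complex linear subspace of the product of the Fock space with itself. The domain
  is its first projection and is therefore a linear subspace as well.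
\<close>

definition mv_linear_operator :: "mv_operator \<Rightarrow> bool" where
  "mv_linear_operator A \<longleftrightarrow>
     mv_graph A \<subseteq> fock_space \<times> fock_space \<and>
     ((\<lambda>_. 0), (\<lambda>_. 0)) \<in> mv_graph A \<and>
     (\<forall>f g h k. (f, g) \<in> mv_graph A \<longrightarrow> (h, k) \<in> mv_graph A \<longrightarrow>
        ((\<lambda>z. f z + h z), (\<lambda>z. g z + k z)) \<in> mv_graph A) \<and>
     (\<forall>c f g. (f, g) \<in> mv_graph A \<longrightarrow>
        ((\<lambda>z. c * f z), (\<lambda>z. c * g z)) \<in> mv_graph A)"

definition single_valued_operator :: "mv_operator \<Rightarrow> bool" where
  "single_valued_operator A \<longleftrightarrow> mv_linear_operator A \<and> (\<forall>f\<in>mv_dom A. \<exists>!g. g \<in> A f)"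

definition mv_adjoint :: "mv_operator \<Rightarrow> mv_operator" where
  "mv_adjoint A u =
     {v. u \<in> fock_space \<and> v \<in> fock_space \<and>
         (\<forall>(f, g)\<in>mv_graph A. fock_inner g u = fock_inner f v)}"

definition mv_weighted_composition_operator ::
  "nat \<Rightarrow> (complex \<Rightarrow> complex) \<Rightarrow> (complex \<Rightarrow> complex) \<Rightarrow> (complex \<Rightarrow> complex) \<Rightarrow>
     mv_operator \<Rightarrow> bool" where
  "mv_weighted_composition_operator m psi varphi phi S \<longleftrightarrow>
     mv_linear_operator S \<and>
     (\<forall>(f, g)\<in>mv_graph S. \<forall>z. psi z * f (varphi z) = phi z * (deriv ^^ m) g z)"

end

theory Submission imports Defs begin

text \<open>
  This is an instance of the general fact that a linear relation with dense domain has a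
  single-valued adjoint. The defining relation of the adjoint is additive and conjugate homogeneous
  in the pair \<open>(u, v)\<close>, because the inner product is so in its second argument; hence two values
  of the adjoint at the same point differ by some \<open>w\<close> orthogonal to the whole domain
  (\<open>adjoint_values_orthogonal\<close>). Such a \<open>w\<close> vanishes: for \<open>f\<close> in the domain, Pythagoras gives
  \<open>\<parallel>w - f\<parallel>\<^sup>2 = \<parallel>w\<parallel>\<^sup>2 + \<parallel>f\<parallel>\<^sup>2 \<ge> \<parallel>w\<parallel>\<^sup>2\<close>, so the domain can approximate \<open>w\<close> only
  if \<open>\<parallel>w\<parallel> = 0\<close>, and the norm is definite on continuous functions
  (\<open>orthogonal_to_dense_imp_zero\<close>).
\<close>

lemma fock_space_measurable: "f \<in> fock_space \<Longrightarrow> f \<in> borel_measurable lborel"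
  by (auto simp: fock_space_def intro!: borel_measurable_continuous_onI holomorphic_on_imp_continuous_on)

text \<open>
  The Bochner integral of a function that is not integrable is \<open>0\<close>, so additivity of the inner
  product rests on integrability of its integrand. On the Fock space this holds because \<open>|f||g|\<close>
  is at most \<open>|f|\<^sup>2 + |g|\<^sup>2\<close>.
\<close>

lemma fock_inner_integrable:
  assumes f: "f \<in> fock_space" and g: "g \<in> fock_space"
  shows "integrable lborel (\<lambda>z. f z * cnj (g z) * complex_of_real (exp (- (norm z)\<^sup>2)))"
proof (rule Bochner_Integration.integrable_bound)
  show "integrable lborel (\<lambda>z. (norm (f z))\<^sup>2 * exp (- (norm z)\<^sup>2) + (norm (g z))\<^sup>2 * exp (- (norm z)\<^sup>2))"
    using f g by (auto simp: fock_space_def)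
  have [measurable]: "f \<in> borel_measurable borel" "g \<in> borel_measurable borel"
    using f g fock_space_measurable by auto
  have [measurable]: "cnj \<in> borel_measurable borel"
    by (intro borel_measurable_continuous_onI continuous_intros)
  show "(\<lambda>z. f z * cnj (g z) * complex_of_real (exp (- (norm z)\<^sup>2))) \<in> borel_measurable lborel"
    by simp
  show "AE z in lborel. norm (f z * cnj (g z) * complex_of_real (exp (- (norm z)\<^sup>2)))
      \<le> norm ((norm (f z))\<^sup>2 * exp (- (norm z)\<^sup>2) + (norm (g z))\<^sup>2 * exp (- (norm z)\<^sup>2))"
  proof (rule AE_I2)
    fix z
    have "norm (f z) * norm (g z) \<le> (norm (f z))\<^sup>2 + (norm (g z))\<^sup>2"
      using sum_squares_bound[of "norm (f z)" "norm (g z)"]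
        mult_nonneg_nonneg[OF norm_ge_zero[of "f z"] norm_ge_zero[of "g z"]] by linarith
    then have "norm (f z) * norm (g z) * exp (- (norm z)\<^sup>2)
        \<le> ((norm (f z))\<^sup>2 + (norm (g z))\<^sup>2) * exp (- (norm z)\<^sup>2)"
      by (rule mult_right_mono) simp
    then show "norm (f z * cnj (g z) * complex_of_real (exp (- (norm z)\<^sup>2)))
      \<le> norm ((norm (f z))\<^sup>2 * exp (- (norm z)\<^sup>2) + (norm (g z))\<^sup>2 * exp (- (norm z)\<^sup>2))"
      by (simp add: norm_mult distrib_right)
  qed
qed

lemma fock_space_zero: "(\<lambda>_. 0) \<in> fock_space"
  by (simp add: fock_space_def)

lemma fock_space_scale: "f \<in> fock_space \<Longrightarrow> (\<lambda>z. c * f z) \<in> fock_space"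
  by (auto simp: fock_space_def norm_mult power_mult_distrib mult.assoc intro!: holomorphic_intros)

lemma fock_space_add:
  assumes f: "f \<in> fock_space" and g: "g \<in> fock_space"
  shows "(\<lambda>z. f z + g z) \<in> fock_space"
proof -
  have [measurable]: "f \<in> borel_measurable borel" "g \<in> borel_measurable borel"
    using f g fock_space_measurable by auto
  have "integrable lborel (\<lambda>z. (norm (f z + g z))\<^sup>2 * exp (- (norm z)\<^sup>2))"
  proof (rule Bochner_Integration.integrable_bound)
    show "integrable lborel (\<lambda>z. 2 * ((norm (f z))\<^sup>2 * exp (- (norm z)\<^sup>2)) + 2 * ((norm (g z))\<^sup>2 * exp (- (norm z)\<^sup>2)))"
      using f g by (auto simp: fock_space_def)
    show "AE z in lborel. norm ((norm (f z + g z))\<^sup>2 * exp (- (norm z)\<^sup>2))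
      \<le> norm (2 * ((norm (f z))\<^sup>2 * exp (- (norm z)\<^sup>2)) + 2 * ((norm (g z))\<^sup>2 * exp (- (norm z)\<^sup>2)))"
    proof (rule AE_I2)
      fix z
      have "(norm (f z + g z))\<^sup>2 \<le> (norm (f z) + norm (g z))\<^sup>2"
        by (intro power_mono norm_triangle_ineq) simp
      also have "\<dots> \<le> 2 * (norm (f z))\<^sup>2 + 2 * (norm (g z))\<^sup>2"
        using sum_squares_bound[of "norm (f z)" "norm (g z)"] by (simp add: power2_sum)
      finally have "(norm (f z + g z))\<^sup>2 * exp (- (norm z)\<^sup>2)
          \<le> (2 * (norm (f z))\<^sup>2 + 2 * (norm (g z))\<^sup>2) * exp (- (norm z)\<^sup>2)"
        by (rule mult_right_mono) simp
      then show "norm ((norm (f z + g z))\<^sup>2 * exp (- (norm z)\<^sup>2))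
        \<le> norm (2 * ((norm (f z))\<^sup>2 * exp (- (norm z)\<^sup>2)) + 2 * ((norm (g z))\<^sup>2 * exp (- (norm z)\<^sup>2)))"
        by (simp add: distrib_right mult.assoc)
    qed
  qed simp
  then show ?thesis
    using f g by (auto simp: fock_space_def intro!: holomorphic_intros)
qed

lemma fock_space_diff:
  assumes "f \<in> fock_space" "g \<in> fock_space"
  shows "(\<lambda>z. f z - g z) \<in> fock_space"
  using fock_space_add[OF assms(1) fock_space_scale[OF assms(2), of "-1"]] by simp

lemma fock_inner_cnj: "fock_inner g f = cnj (fock_inner f g)"
proof -
  have "cnj (\<integral>z. f z * cnj (g z) * complex_of_real (exp (- (norm z)\<^sup>2)) \<partial>lborel)
      = (\<integral>z. cnj (f z * cnj (g z) * complex_of_real (exp (- (norm z)\<^sup>2))) \<partial>lborel)"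
    by (rule Bochner_Integration.integral_cnj[symmetric])
  then show ?thesis
    by (simp add: fock_inner_def mult.commute[of "g _"])
qed

lemma fock_inner_zero_right: "fock_inner f (\<lambda>_. 0) = 0"
  by (simp add: fock_inner_def)

lemma fock_inner_add_right:
  assumes "f \<in> fock_space" "g \<in> fock_space" "h \<in> fock_space"
  shows "fock_inner f (\<lambda>z. g z + h z) = fock_inner f g + fock_inner f h"
  using fock_inner_integrable[OF assms(1,2)] fock_inner_integrable[OF assms(1,3)]
  by (simp add: fock_inner_def distrib_left distrib_right add_divide_distrib)

lemma fock_inner_scale_right: "fock_inner f (\<lambda>z. c * g z) = cnj c * fock_inner f g"
proof -
  have "(\<lambda>z. f z * cnj (c * g z) * complex_of_real (exp (- (norm z)\<^sup>2)))
      = (\<lambda>z. cnj c * (f z * cnj (g z) * complex_of_real (exp (- (norm z)\<^sup>2))))"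
    by (simp add: fun_eq_iff ac_simps)
  then show ?thesis
    by (simp add: fock_inner_def)
qed

lemma fock_inner_diff_right:
  assumes "f \<in> fock_space" "g \<in> fock_space" "h \<in> fock_space"
  shows "fock_inner f (\<lambda>z. g z - h z) = fock_inner f g - fock_inner f h"
  using fock_inner_add_right[OF assms(1,2) fock_space_scale[OF assms(3), of "-1"]]
    fock_inner_scale_right[of f "-1" h] by simp

lemma fock_inner_self:
  "Re (fock_inner f f) = (\<integral>z. (norm (f z))\<^sup>2 * exp (- (norm z)\<^sup>2) \<partial>lborel) / pi"
proof -
  have "(\<lambda>z. f z * cnj (f z) * complex_of_real (exp (- (norm z)\<^sup>2)))
      = (\<lambda>z. complex_of_real ((norm (f z))\<^sup>2 * exp (- (norm z)\<^sup>2)))"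
    by (simp add: fun_eq_iff complex_norm_square[symmetric])
  then have "fock_inner f f = 1 / complex_of_real pi *
      complex_of_real (\<integral>z. (norm (f z))\<^sup>2 * exp (- (norm z)\<^sup>2) \<partial>lborel)"
    by (simp only: fock_inner_def integral_complex_of_real)
  also have "\<dots> = complex_of_real ((\<integral>z. (norm (f z))\<^sup>2 * exp (- (norm z)\<^sup>2) \<partial>lborel) / pi)"
    by simp
  finally show ?thesis
    by (metis Re_complex_of_real)
qed

lemma fock_inner_self_nonneg: "0 \<le> Re (fock_inner f f)"
  unfolding fock_inner_self by (intro divide_nonneg_pos integral_nonneg_AE) auto

text \<open>
  A vanishing integral only forces \<open>f\<close> to vanish almost everywhere. The set where \<open>f\<close> is nonzero
  is then open and of measure zero, hence empty.
\<close>

lemma fock_inner_definite: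
  assumes f: "f \<in> fock_space" and zero: "Re (fock_inner f f) = 0"
  shows "f = (\<lambda>_. 0)"
proof -
  have int: "integrable lborel (\<lambda>z. (norm (f z))\<^sup>2 * exp (- (norm z)\<^sup>2))"
    and cont: "continuous_on UNIV f"
    using f by (auto simp: fock_space_def holomorphic_on_imp_continuous_on)
  have "(\<integral>z. (norm (f z))\<^sup>2 * exp (- (norm z)\<^sup>2) \<partial>lborel) = 0"
    using zero by (simp add: fock_inner_self)
  then have "AE z in lborel. (norm (f z))\<^sup>2 * exp (- (norm z)\<^sup>2) = 0"
    using integral_nonneg_eq_0_iff_AE[OF int] by simp
  then have "AE z in lborel. z \<notin> {z. f z \<noteq> 0}"
    by simp
  moreover have op: "open {z. f z \<noteq> 0}"
    using cont by (intro open_Collect_neq) auto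
  ultimately have "{z. f z \<noteq> 0} \<in> null_sets lborel"
    by (subst AE_iff_null_sets) auto
  then have "negligible {z. f z \<noteq> 0}"
    by (simp add: negligible_iff_null_sets null_sets_completionI)
  then have "{z. f z \<noteq> 0} = {}"
    using op open_not_negligible by blast
  then show ?thesis
    by auto
qed

text \<open>
  If \<open>w\<close> were nonzero, its own norm would be an admissible tolerance for the approximation; but
  by Pythagoras an element orthogonal to \<open>w\<close> is never closer to \<open>w\<close> than \<open>0\<close> is.
\<close>

lemma orthogonal_to_dense_imp_zero:
  assumes dense: "fock_dense D" and w: "w \<in> fock_space"
    and orth: "\<And>f. f \<in> D \<Longrightarrow> fock_inner f w = 0"
  shows "w = (\<lambda>_. 0)"
proof (rule ccontr)
  assume "w \<noteq> (\<lambda>_. 0)"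
  then have "0 < Re (fock_inner w w)"
    using fock_inner_definite[OF w] fock_inner_self_nonneg[of w] by linarith
  then have "0 < fock_norm w"
    by (simp add: fock_norm_def)
  then obtain f where fD: "f \<in> D" and near: "fock_norm (\<lambda>z. w z - f z) < fock_norm w"
    using dense w unfolding fock_dense_def by blast
  have f: "f \<in> fock_space"
    using dense fD by (auto simp: fock_dense_def)
  let ?d = "\<lambda>z. w z - f z"
  have d: "?d \<in> fock_space"
    using w f by (rule fock_space_diff)
  have fw: "fock_inner f w = 0" and wf: "fock_inner w f = 0"
    using orth[OF fD] fock_inner_cnj[of w f] by simp_all
  have "fock_inner ?d w = fock_inner w w"
    using fock_inner_cnj[of ?d w] fock_inner_cnj[of w w] fock_inner_diff_right[OF w w f] wf
    by simp
  moreover have "fock_inner ?d f = - fock_inner f f"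
    using fock_inner_cnj[of ?d f] fock_inner_cnj[of f f] fock_inner_diff_right[OF f w f] fw
    by simp
  ultimately have "fock_inner ?d ?d = fock_inner w w + fock_inner f f"
    using fock_inner_diff_right[OF d w f] by simp
  then have "fock_norm w \<le> fock_norm ?d"
    using fock_inner_self_nonneg[of f] by (simp add: fock_norm_def)
  with near show False
    by simp
qed

lemma mv_graph_iff: "(f, g) \<in> mv_graph A \<longleftrightarrow> g \<in> A f"
  by (auto simp: mv_graph_def mv_dom_def)

lemma mv_linear_operator_adjoint:
  assumes graph: "mv_graph A \<subseteq> fock_space \<times> fock_space"
  shows "mv_linear_operator (mv_adjoint A)"
  unfolding mv_linear_operator_def mv_graph_iff
proof (intro conjI allI impI)
  show "mv_graph (mv_adjoint A) \<subseteq> fock_space \<times> fock_space"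
    by (auto simp: mv_graph_iff mv_adjoint_def)
  show "(\<lambda>_. 0) \<in> mv_adjoint A (\<lambda>_. 0)"
    by (simp add: mv_adjoint_def fock_space_zero fock_inner_zero_right)
  show "(\<lambda>z. v z + y z) \<in> mv_adjoint A (\<lambda>z. u z + x z)"
    if "v \<in> mv_adjoint A u" "y \<in> mv_adjoint A x" for u v x y
    using that graph by (fastforce simp: mv_adjoint_def fock_space_add fock_inner_add_right)
  show "(\<lambda>z. c * v z) \<in> mv_adjoint A (\<lambda>z. c * u z)"
    if "v \<in> mv_adjoint A u" for c u v
    using that by (auto simp: mv_adjoint_def fock_space_scale fock_inner_scale_right)
qed

text \<open>
  A point \<open>f\<close> of the domain has some image \<open>g\<close>, and the pair \<open>(f, g)\<close> forces the same inner
  product \<open>\<langle>g, u\<rangle>\<close> of \<open>f\<close> with every value of the adjoint at \<open>u\<close>.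
\<close>

lemma adjoint_values_orthogonal:
  assumes graph: "mv_graph A \<subseteq> fock_space \<times> fock_space"
    and v: "v \<in> mv_adjoint A u" and v': "v' \<in> mv_adjoint A u" and f: "f \<in> mv_dom A"
  shows "fock_inner f (\<lambda>z. v z - v' z) = 0"
proof -
  obtain g where fg: "(f, g) \<in> mv_graph A"
    using f by (auto simp: mv_dom_def mv_graph_iff)
  then have "f \<in> fock_space" "fock_inner f v = fock_inner g u" "fock_inner f v' = fock_inner g u"
    using graph v v' by (auto simp: mv_adjoint_def)
  moreover have "v \<in> fock_space" "v' \<in> fock_space"
    using v v' by (auto simp: mv_adjoint_def)
  ultimately show ?thesis
    by (simp add: fock_inner_diff_right)
qed

lemma adjoint_of_densely_defined_unique:
  assumes graph: "mv_graph A \<subseteq> fock_space \<times> fock_space" and dense: "fock_dense (mv_dom A)"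
    and v: "v \<in> mv_adjoint A u" and v': "v' \<in> mv_adjoint A u"
  shows "v = v'"
proof -
  have "(\<lambda>z. v z - v' z) \<in> fock_space"
    using v v' by (auto simp: mv_adjoint_def intro: fock_space_diff)
  then have "(\<lambda>z. v z - v' z) = (\<lambda>_. 0)"
    using orthogonal_to_dense_imp_zero[OF dense] adjoint_values_orthogonal[OF graph v v'] by blast
  then show ?thesis
    by (simp add: fun_eq_iff)
qed

theorem proposition3p10:
  fixes m :: nat
    and psi varphi phi :: "complex \<Rightarrow> complex"
    and S :: mv_operator
  assumes "psi holomorphic_on UNIV"
    and "varphi holomorphic_on UNIV"
    and "phi holomorphic_on UNIV"
    and "mv_weighted_composition_operator m psi varphi phi S"
    and "fock_dense (mv_dom S)"
  shows "single_valued_operator (mv_adjoint S) \<and> mv_adjoint S (\<lambda>_. 0) = {\<lambda>_. 0}"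
proof -
  have graph: "mv_graph S \<subseteq> fock_space \<times> fock_space"
    using assms(4) by (auto simp: mv_weighted_composition_operator_def mv_linear_operator_def)
  have lin: "mv_linear_operator (mv_adjoint S)"
    using graph by (rule mv_linear_operator_adjoint)
  have unique: "v = v'" if "v \<in> mv_adjoint S u" "v' \<in> mv_adjoint S u" for u v v'
    using adjoint_of_densely_defined_unique[OF graph assms(5) that] .
  have "single_valued_operator (mv_adjoint S)"
    using lin unique by (auto simp: single_valued_operator_def mv_dom_def)
  moreover have "(\<lambda>_. 0) \<in> mv_adjoint S (\<lambda>_. 0)"
    using lin by (simp add: mv_linear_operator_def mv_graph_iff)
  ultimately show ?thesis
    using unique by blast
qed

end
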